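(* Let $b\ge 2$ be an integer. For $N\in\mathbb{N}$ let \[ \nu_N=\frac{1}{N}\sum_{n=1}^{N}\delta_{\langle \log_b n\rangle}, \] a Borel probability measure on the circle $\mathbb{T}\equiv[0,1[$, and let $\mu^{(N)}:=E_b\circ R^{-1}_{\langle -\log_b N\rangle}$ be the push-forward of the measure $E_b$ (with distribution function $F_{E_b}(t)=\frac{b^t-1}{b-1}$, $t\in[0,1]$, viewed on $\mathbb{T}$) under the rotation $R_y(t)=\langle t+y\rangle$ with $y=\langle -\log_b N\rangle$. Then \[ \limsup_{N\to\infty}\frac{N}{\sqrt{\log N}}\, d_{\mathbb{T}}\big(\nu_N,\ E_b\circ R^{-1}_{\langle -\log_b N\rangle}\big)<\infty . \]
   Context: $\langle a\rangle$ denotes the fractional part of $a\in\mathbb{R}$ and $\delta_a$ the Dirac measure at $a$. The circle $\mathbb{T}$ is identified with $[0,1[$ via $t\mapsto e^{2\pi i t}$, with metric $\rho_{\mathbb{T}}(x,y)=\min\{|x-y|,1-|x-y|\}$. For Borel probability measures $\mu,\nu$ on $\mathbb{T}$, the Kantorovich distance is $d_{\mathbb{T}}(\mu,\nu)=\inf_\gamma\int_{\mathbb{T}\times\mathbb{T}}\rho_{\mathbb{T}}(x,y)\,\gamma(dx,dy)$, the infimum over all Borel probability measures $\gamma$ on $\mathbb{T}\times\mathbb{T}$ with marginals $\mu$ and $\nu$. $E_b$ is the exponential distribution with parameter $\log b$ on $[0,1]$ (distribution function $F_{E_b}(t)=\frac{b^t-1}{b-1}$), regarded as a measure on $\mathbb{T}$;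 $E_b\circ R_y^{-1}$ has distribution function $t\mapsto \big\langle \frac{b^{\langle t+y\rangle}-b^y}{b-1}\big\rangle$ for $t\in[0,1[$. $\log$ is the natural logarithm.
   Formalization: The measure E_b∘R_y^{-1} is taken as the one with distribution function ⟨(b^{⟨t+y⟩}−b^y)/(b−1)⟩, i.e. E_b rotated by −y (by +log_b N), not the push-forward of E_b under R_y; with the literal push-forward the claim fails, e.g. b=10, N=2·10^k. *)

theory Defs
  imports "HOL-Probability.Probability"
begin

section \<open>The circle, identified with \<open>{0..<1}\<close>\<close>

definition circle_dist :: "real \<Rightarrow> real \<Rightarrow> real" where
  "circle_dist x y = min \<bar>x - y\<bar> (1 - \<bar>x - y\<bar>)"

text \<open>
  The topologies of \<open>circle_dist\<close> and of the real line differ on \<open>{0..<1}\<close> (at the point 0), but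
  they have the same Borel sets: see \<open>sets_circle\<close> below.
\<close>
definition circle :: "real measure" where
  "circle = restrict_space borel {0..<1}"

definition rotation :: "real \<Rightarrow> real \<Rightarrow> real" where
  "rotation y t = frac (t + y)"

lemma space_circle [simp]: "space circle = {0..<1}"
  by (simp add: circle_def)

lemma sets_circle_iff: "A \<in> sets circle \<longleftrightarrow> A \<in> sets borel \<and> A \<subseteq> {0..<1}"
  by (auto simp: circle_def sets_restrict_space_iff)

definition circle_open :: "real set \<Rightarrow> bool" where
  "circle_open U \<longleftrightarrow> U \<subseteq> {0..<1} \<and>
     (\<forall>x\<in>U. \<exists>r>0. \<forall>y\<in>{0..<1}. circle_dist x y < r \<longrightarrow> y \<in> U)"

lemma circle_open_if_open:
  assumes "open U" "U \<subseteq> {0<..<1}"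
  shows "circle_open U"
  unfolding circle_open_def
proof (intro conjI ballI)
  show "U \<subseteq> {0..<1}" using assms(2) by force
  fix x assume x: "x \<in> U"
  then obtain e where e: "e > 0" "\<And>y. dist y x < e \<Longrightarrow> y \<in> U"
    using assms(1) unfolding open_dist by blast
  have x01: "0 < x" "x < 1" using x assms(2) by auto
  define r where "r = min e (min x (1 - x))"
  have "r > 0" using e x01 by (auto simp: r_def)
  moreover have "y \<in> U" if "y \<in> {0..<1}" "circle_dist x y < r" for y
  proof -
    have "\<bar>x - y\<bar> < e"
      using x01 that by (auto simp: circle_dist_def r_def min_def abs_if split: if_splits)
    then show "y \<in> U" using e by (auto simp: dist_real_def abs_minus_commute)
  qed
  ultimately show "\<exists>r>0. \<forall>y\<in>{0..<1}. circle_dist x y < r \<longrightarrow> y \<in> U" by blast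
qed

lemma open_if_circle_open:
  assumes "circle_open U"
  shows "open (U \<inter> {0<..<1})"
  unfolding open_dist
proof
  fix x assume x: "x \<in> U \<inter> {0<..<1}"
  then obtain r where r: "r > 0" "\<forall>y\<in>{0..<1}. circle_dist x y < r \<longrightarrow> y \<in> U"
    using assms unfolding circle_open_def by blast
  define e where "e = min r (min x (1 - x))"
  have "e > 0" using x r by (auto simp: e_def)
  moreover have "\<forall>y. dist y x < e \<longrightarrow> y \<in> U \<inter> {0<..<1}"
  proof (intro allI impI)
    fix y assume "dist y x < e"
    then have y: "\<bar>x - y\<bar> < r" "0 < y" "y < 1"
      by (auto simp: e_def dist_real_def abs_if split: if_splits)
    then have "circle_dist x y < r" by (simp add: circle_dist_def)
    then show "y \<in> U \<inter> {0<..<1}" using r y by auto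
  qed
  ultimately show "\<exists>e>0. \<forall>y. dist y x < e \<longrightarrow> y \<in> U \<inter> {0<..<1}" by blast
qed

lemma sets_circle: "sets circle = sigma_sets {0..<1} {U. circle_open U}"
  (is "_ = ?S")
proof
  interpret S: sigma_algebra "{0..<1::real}" ?S
    by (rule sigma_algebra_sigma_sets) (auto simp: circle_open_def)
  have zero: "{0} \<in> ?S"
  proof -
    have "{0<..<1::real} \<in> ?S"
      by (intro sigma_sets.Basic) (simp add: circle_open_if_open)
    then have "{0..<1} - {0<..<1::real} \<in> ?S" by blast
    moreover have "{0..<1} - {0<..<1::real} = {0}" by auto
    ultimately show ?thesis by simp
  qed
  have "sets circle = sigma_sets {0..<1} ((\<inter>) {0..<1} ` {U. open U})"
  proof -
    have "{0..<1::real} \<in> sigma_sets UNIV {U. open U}"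
      by (simp flip: sets_borel)
    then show ?thesis
      unfolding circle_def sets_restrict_space sets_borel by (rule sigma_sets_Int) simp
  qed
  also have "\<dots> \<subseteq> ?S"
  proof (rule sigma_sets_mono, safe)
    fix U :: "real set" assume U: "open U"
    have eq: "{0..<1} \<inter> U = (U \<inter> {0<..<1}) \<union> (if 0 \<in> U then {0} else {})"
      by (auto simp: less_le)
    have "U \<inter> {0<..<1} \<in> ?S"
      using U by (intro sigma_sets.Basic) (auto intro!: circle_open_if_open)
    then show "{0..<1} \<inter> U \<in> ?S"
      unfolding eq using zero by (intro S.Un) (simp_all add: S.empty_sets)
  qed
  finally show "sets circle \<subseteq> ?S" .
next
  have "{U. circle_open U} \<subseteq> sets circle"
  proof safe
    fix U assume U: "circle_open U"
    then have sub: "U \<subseteq> {0..<1}" by (simp add: circle_open_def)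
    then have eq: "U = (U \<inter> {0<..<1}) \<union> (if 0 \<in> U then {0} else {})"
      by (auto simp: less_le)
    have "(U \<inter> {0<..<1}) \<union> (if 0 \<in> U then {0} else {}) \<in> sets borel"
      using open_if_circle_open[OF U] by auto
    then show "U \<in> sets circle" using sub eq by (simp add: sets_circle_iff)
  qed
  then show "?S \<subseteq> sets circle"
    using sets.sigma_sets_subset[of _ circle] by simp
qed

lemma frac_measurable_circle [measurable]: "frac \<in> borel \<rightarrow>\<^sub>M circle"
  unfolding circle_def
proof (rule measurable_restrict_space2)
  have "(\<lambda>x::real. x - of_int \<lfloor>x\<rfloor>) \<in> borel_measurable borel" by measurable
  then show "(frac :: real \<Rightarrow> real) \<in> borel_measurable borel" by (simp add: frac_def[abs_def])
qed (auto simp: frac_lt_1)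

lemma rotation_measurable [measurable]: "rotation y \<in> circle \<rightarrow>\<^sub>M circle"
proof -
  have "(\<lambda>t. frac (t + y)) \<in> circle \<rightarrow>\<^sub>M circle"
    by (rule measurable_compose[OF _ frac_measurable_circle])
       (auto simp: circle_def intro!: measurable_restrict_space1)
  then show ?thesis by (simp add: rotation_def[abs_def])
qed


section \<open>The Kantorovich distance on the circle\<close>

text \<open>
  \<open>circle \<Otimes>\<^sub>M circle\<close> is the Borel \<open>\<sigma>\<close>-algebra of the product, the circle being second countable.
\<close>
definition couplings :: "real measure \<Rightarrow> real measure \<Rightarrow> (real \<times> real) measure set" where
  "couplings \<mu> \<nu> = {\<gamma>. prob_space \<gamma> \<and> sets \<gamma> = sets (circle \<Otimes>\<^sub>M circle) \<and>
     distr \<gamma> circle fst = \<mu> \<and> distr \<gamma> circle snd = \<nu>}"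

definition kantorovich_circle :: "real measure \<Rightarrow> real measure \<Rightarrow> real" where
  "kantorovich_circle \<mu> \<nu> =
     (INF \<gamma>\<in>couplings \<mu> \<nu>. \<integral>p. circle_dist (fst p) (snd p) \<partial>\<gamma>)"


section \<open>The empirical measures\<close>

definition empirical_circle :: "(nat \<Rightarrow> real) \<Rightarrow> nat \<Rightarrow> real measure" where
  "empirical_circle x N =
     measure_of (space circle) (sets circle)
       (\<lambda>A. (\<Sum>n=1..N. emeasure (return circle (x n)) A) / of_nat N)"

lemma sets_empirical_circle [simp, measurable_cong]: "sets (empirical_circle x N) = sets circle"
  using sets.sigma_sets_eq[of circle] sets.space_closed[of circle]
  unfolding empirical_circle_def by (simp add: sets_measure_of)

lemma space_empirical_circle [simp]: "space (empirical_circle x N) = {0..<1}"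
  using sets_eq_imp_space_eq[OF sets_empirical_circle] by simp

lemma emeasure_empirical_circle:
  assumes "A \<in> sets circle"
  shows "emeasure (empirical_circle x N) A =
           (\<Sum>n=1..N. emeasure (return circle (x n)) A) / of_nat N"
  unfolding empirical_circle_def
proof (rule emeasure_measure_of_sigma)
  show "countably_additive (sets circle)
          (\<lambda>A. (\<Sum>n=1..N. emeasure (return circle (x n)) A) / of_nat N)"
  proof (rule countably_additiveI)
    fix A :: "nat \<Rightarrow> real set"
    assume A: "range A \<subseteq> sets circle" "disjoint_family A"
    have "(\<Sum>i. (\<Sum>n=1..N. emeasure (return circle (x n)) (A i)) / of_nat N) =
          (\<Sum>i. \<Sum>n=1..N. emeasure (return circle (x n)) (A i)) / of_nat N"
      by (rule ennreal_suminf_divide)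
    also have "(\<Sum>i. \<Sum>n=1..N. emeasure (return circle (x n)) (A i)) =
          (\<Sum>n=1..N. \<Sum>i. emeasure (return circle (x n)) (A i))"
      by (intro suminf_sum) auto
    also have "\<dots> = (\<Sum>n=1..N. emeasure (return circle (x n)) (\<Union>i. A i))"
      using A by (intro sum.cong refl suminf_emeasure) auto
    finally show "(\<Sum>i. (\<Sum>n=1..N. emeasure (return circle (x n)) (A i)) / of_nat N) =
          (\<Sum>n=1..N. emeasure (return circle (x n)) (\<Union>i. A i)) / of_nat N" .
  qed
qed (use assms in \<open>auto simp: positive_def intro: sets.sigma_algebra_axioms simp del: space_circle\<close>)

lemma prob_space_empirical_circle:
  assumes "N > 0" "\<And>n. x n \<in> {0..<1}"
  shows "prob_space (empirical_circle x N)"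
proof
  have "{0..<1} \<in> sets circle" using sets.top[of circle] by simp
  then have "emeasure (empirical_circle x N) {0..<1} = of_nat N / of_nat N"
    using assms by (simp add: emeasure_empirical_circle emeasure_return indicator_def)
  also have "\<dots> = 1" using assms by (simp add: ennreal_of_nat_eq_real_of_nat flip: divide_ennreal)
  finally show "emeasure (empirical_circle x N) (space (empirical_circle x N)) = 1" by simp
qed


section \<open>The exponential distribution and its rotations\<close>

text \<open>The distribution function on \<open>{0..1}\<close>, continued by 0 to the left and by 1 to the right.\<close>
definition expo_cdf :: "real \<Rightarrow> real \<Rightarrow> real" where
  "expo_cdf b t = (b powr (min 1 (max 0 t)) - 1) / (b - 1)"

definition expo_circle :: "real \<Rightarrow> real measure" where
  "expo_circle b = distr (interval_measure (expo_cdf b)) circle frac"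

text \<open>
  The measure written \<open>E_b \<circ> R_y\<^sup>-\<^sup>1\<close>. It is fixed by its distribution function
  \<open>t \<mapsto> \<langle>(b^\<langle>t + y\<rangle> - b^y) / (b - 1)\<rangle>\<close> (lemma \<open>measure_rotated_expo\<close>): it gives a set \<open>A\<close> the mass
  \<open>E_b (R_y A)\<close> with \<open>R_y t = \<langle>t + y\<rangle>\<close>, so that it is the image of \<open>E_b\<close> under the rotation
  by \<open>- y\<close>. The image of \<open>E_b\<close> under \<open>R_y\<close> itself would have this distribution
  function with \<open>\<langle>- y\<rangle>\<close> in place of \<open>y\<close>.
\<close>
definition rotated_expo :: "real \<Rightarrow> real \<Rightarrow> real measure" where
  "rotated_expo b y = distr (expo_circle b) circle (rotation (- y))"

lemma expo_cdf_mono: "b > 1 \<Longrightarrow> s \<le> t \<Longrightarrow> expo_cdf b s \<le> expo_cdf b t"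
  unfolding expo_cdf_def by (intro divide_right_mono diff_right_mono powr_mono) auto

lemma continuous_expo_cdf: "b > 1 \<Longrightarrow> continuous_on UNIV (expo_cdf b)"
  unfolding expo_cdf_def by (intro continuous_intros) auto

lemma expo_cdf_eq: "0 \<le> t \<Longrightarrow> t \<le> 1 \<Longrightarrow> expo_cdf b t = (b powr t - 1) / (b - 1)"
  by (simp add: expo_cdf_def)

lemma
  assumes b: "b > 1"
  shows real_distribution_expo: "real_distribution (interval_measure (expo_cdf b))"
    and measure_expo_Icc: "s \<le> t \<Longrightarrow>
      measure (interval_measure (expo_cdf b)) {s..t} = expo_cdf b t - expo_cdf b s"
    and AE_expo: "AE t in interval_measure (expo_cdf b). t \<in> {0<..<1}"
proof -
  let ?F = "expo_cdf b" let ?P = "interval_measure ?F"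
  have isc: "isCont ?F t" for t
    using continuous_expo_cdf[OF b] by (simp add: continuous_on_eq_continuous_at)
  then have rc: "continuous (at_right t) ?F" for t
    by (simp add: continuous_at_imp_continuous_at_within)
  have bot: "(?F \<longlongrightarrow> 0) at_bot"
    by (rule tendsto_eventually)
       (use eventually_le_at_bot[of "0::real"] in eventually_elim, use b in \<open>simp add: expo_cdf_def\<close>)
  have top: "(?F \<longlongrightarrow> 1) at_top"
    by (rule tendsto_eventually)
       (use eventually_ge_at_top[of "1::real"] in eventually_elim, use b in \<open>simp add: expo_cdf_def\<close>)
  show rd: "real_distribution ?P"
    by (rule real_distribution_interval_measure[OF expo_cdf_mono[OF b] rc bot top])
  then interpret real_distribution ?P .
  show Icc: "s \<le> t \<Longrightarrow> measure ?P {s..t} = ?F t - ?F s" for s t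
    using emeasure_interval_measure_Icc[of s t ?F, OF _ expo_cdf_mono[OF b] continuous_expo_cdf[OF b]]
      expo_cdf_mono[OF b, of s t]
    by (simp add: measure_def)
  have "measure ?P {0..1} = 1" using Icc[of 0 1] b by (simp add: expo_cdf_def)
  then have "AE t in ?P. t \<in> {0..1}" by (intro AE_prob_1) simp
  moreover have "AE t in ?P. t \<notin> {a}" for a
    using Icc[of a a] by (intro AE_not_in) (auto simp: null_sets_def emeasure_eq_measure)
  note this[of 0] this[of 1]
  ultimately show "AE t in ?P. t \<in> {0<..<1}"
    by eventually_elim auto
qed

lemma prob_space_expo_circle: "b > 1 \<Longrightarrow> prob_space (expo_circle b)"
  using real_distribution_expo[of b] unfolding expo_circle_def
  by (intro prob_space.prob_space_distr) (auto simp: real_distribution_def)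

lemma prob_space_rotated_expo: "b > 1 \<Longrightarrow> prob_space (rotated_expo b y)"
  unfolding rotated_expo_def
  by (intro prob_space.prob_space_distr prob_space_expo_circle)
     (auto simp: expo_circle_def)

lemma measure_expo_circle:
  assumes b: "b > 1" and t: "0 \<le> t" "t < 1"
  shows "measure (expo_circle b) {0..t} = (b powr t - 1) / (b - 1)"
proof -
  let ?P = "interval_measure (expo_cdf b)"
  interpret real_distribution ?P by (rule real_distribution_expo[OF b])
  have "{0..t} \<in> sets circle" using t by (auto simp: sets_circle_iff)
  then have "measure (expo_circle b) {0..t} = measure ?P (frac -` {0..t})"
    unfolding expo_circle_def by (subst measure_distr) auto
  also have "\<dots> = measure ?P {0..t}"
  proof (rule finite_measure_eq_AE)
    show "AE s in ?P. s \<in> frac -` {0..t} \<longleftrightarrow> s \<in> {0..t}"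
      using AE_expo[OF b] by eventually_elim (simp add: frac_eq[THEN iffD2])
    have "frac -` {0..t} \<inter> space borel \<in> sets borel"
      using measurable_sets[OF frac_measurable_circle \<open>{0..t} \<in> sets circle\<close>] .
    then show "frac -` {0..t} \<in> events" by simp
  qed auto
  also have "\<dots> = (b powr t - 1) / (b - 1)"
    using measure_expo_Icc[OF b, of 0 t] t b by (simp add: expo_cdf_def)
  finally show ?thesis .
qed

lemma measure_rotated_expo:
  assumes b: "b > 1" and y: "0 \<le> y" "y < 1" and t: "0 \<le> t" "t < 1"
  shows "measure (rotated_expo b y) {0..t} = frac ((b powr frac (t + y) - b powr y) / (b - 1))"
proof -
  let ?F = "expo_cdf b" let ?P = "interval_measure ?F"
  interpret real_distribution ?P by (rule real_distribution_expo[OF b])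
  have t_in: "{0..t} \<in> sets circle" using t by (auto simp: sets_circle_iff)
  have eq: "rotated_expo b y = distr ?P circle (\<lambda>s. rotation (- y) (frac s))"
    unfolding rotated_expo_def expo_circle_def by (subst distr_distr) (auto simp: comp_def)
  let ?A = "(\<lambda>s. rotation (- y) (frac s)) -` {0..t}"
  have meas: "(\<lambda>s. rotation (- y) (frac s)) \<in> borel \<rightarrow>\<^sub>M circle" by measurable
  have A: "?A \<in> sets borel" using measurable_sets[OF meas t_in] by simp
  have 1: "measure (rotated_expo b y) {0..t} = measure ?P ?A"
    unfolding eq using t_in by (subst measure_distr) auto
  have frac_diff: "frac (s - y) = (if y \<le> s then s - y else s - y + 1)"
    if "0 < s" "s < 1" for s
  proof (cases "y \<le> s")
    case True
    then show ?thesis using that y by (simp add: frac_eq)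
  next
    case False
    then have "frac (s - y + 1) = s - y + 1" using that y by (subst frac_eq) auto
    then show ?thesis using False by (simp add: frac_1_eq)
  qed
  have split: "(b powr u - b powr v) / (b - 1) = (b powr u - 1) / (b - 1) - (b powr v - 1) / (b - 1)"
    for u v by (simp add: diff_divide_distrib)
  have lt: "(b powr u - 1) / (b - 1) < (b powr v - 1) / (b - 1)" if "u < v" for u v
    using that b by (simp add: divide_strict_right_mono)
  show ?thesis
  proof (cases "t + y < 1")
    case True
    have "measure ?P ?A = measure ?P {y..t + y}"
    proof (rule finite_measure_eq_AE)
      show "AE s in ?P. s \<in> ?A \<longleftrightarrow> s \<in> {y..t + y}"
        using AE_expo[OF b]
        by eventually_elim (use y t True in \<open>auto simp: rotation_def frac_eq[THEN iffD2] frac_diff\<close>)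
    qed (use A in auto)
    also have "\<dots> = (b powr (t + y) - b powr y) / (b - 1)"
      using measure_expo_Icc[OF b, of y "t + y"] t y True by (simp add: expo_cdf_eq split)
    also have "\<dots> = frac \<dots>"
    proof -
      have "b powr (t + y) < b" using b True powr_less_mono[of "t + y" 1 b] by simp
      moreover have "b powr y \<ge> 1" using b y by (simp add: ge_one_powr_ge_zero)
      ultimately have "(b powr (t + y) - b powr y) / (b - 1) < 1" using b by (simp add: field_simps)
      moreover have "(b powr (t + y) - b powr y) / (b - 1) \<ge> 0" using b t by simp
      ultimately show ?thesis by (simp add: frac_eq[THEN iffD2])
    qed
    also have "frac (t + y) = t + y" using t y True by (simp add: frac_eq)
    ultimately show ?thesis using 1 by simp
  next
    case False
    have fr: "frac (t + y) = t + y - 1"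
    proof -
      have "frac (t + y - 1 + 1) = frac (t + y - 1)" by (rule frac_1_eq)
      also have "\<dots> = t + y - 1" using False t y by (subst frac_eq) auto
      finally show ?thesis by simp
    qed
    have "measure ?P ?A = measure ?P ({0..t + y - 1} \<union> {y..1})"
    proof (rule finite_measure_eq_AE)
      show "AE s in ?P. s \<in> ?A \<longleftrightarrow> s \<in> {0..t + y - 1} \<union> {y..1}"
        using AE_expo[OF b]
        by eventually_elim (use y t False in \<open>auto simp: rotation_def frac_eq[THEN iffD2] frac_diff\<close>)
    qed (use A in auto)
    also have "\<dots> = measure ?P {0..t + y - 1} + measure ?P {y..1}"
      using t by (intro finite_measure_Union) auto
    finally have 2: "measure ?P ?A = measure ?P {0..t + y - 1} + measure ?P {y..1}" .
    also have "\<dots> = (b powr (t + y - 1) - b powr y) / (b - 1) + 1"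
      using measure_expo_Icc[OF b, of 0 "t + y - 1"] measure_expo_Icc[OF b, of y 1] t y False b
      by (simp add: expo_cdf_eq split)
    finally have 3: "measure ?P ?A = (b powr (t + y - 1) - b powr y) / (b - 1) + 1" .
    have "(b powr (t + y - 1) - b powr y) / (b - 1) < 0"
      using lt[of "t + y - 1" y] t by (simp add: split)
    then have "measure ?P ?A = frac (measure ?P ?A)"
      using 3 measure_nonneg[of ?P ?A] by (simp add: frac_eq[THEN iffD2])
    also have "\<dots> = frac ((b powr (t + y - 1) - b powr y) / (b - 1))"
      unfolding 3 by (rule frac_1_eq)
    finally show ?thesis using 1 fr by simp
  qed
qed

end

theory Submission
  imports Defs
begin

text \<open>
  Multiplying each \<open>n \<le> N\<close> by the power of \<open>b\<close> that moves it into \<open>(N/b, N]\<close> does not change its point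
  on the circle. Under \<open>v \<mapsto> \<langle>log\<^sub>b v\<rangle>\<close> the rotated exponential distribution is the image of the uniform
  distribution on \<open>(N/b, N]\<close>, and by Legendre's formula
  \<open>(b - 1) (\<Sum>i. \<lfloor>m / b\<^sup>i\<rfloor>) = b m - s(m)\<close> the discrepancy of the moved points at an integer \<open>m\<close> is
  \<open>(s(N) - s(m)) / (b - 1)\<close> with \<open>s\<close> the base-\<open>b\<close> digit sum. On the circle the ranks may be shifted
  cyclically, which replaces \<open>s(N)\<close> by the mean \<open>J (b - 1) / 2\<close> of the digit sums of \<open>J\<close>-digit numbers.
  The digits are independent, so the mean square deviation of \<open>s\<close> is of order \<open>J \<approx> log N\<close>, and
  each unit of rank costs a distance of order \<open>1 / N\<close>.
\<close>

section \<open>Transport onto an empirical measure\<close>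

text \<open>The circle distance is the least distance between lifts of the two points to the line,
  so every choice of lifts, that is every integer k, bounds it from above.\<close>

lemma circle_dist_frac_le: "circle_dist (frac x) (frac y) \<le> \<bar>x - y + of_int k\<bar>"
proof -
  define d where "d = frac x - frac y"
  define l where "l = k + \<lfloor>x\<rfloor> - \<lfloor>y\<rfloor>"
  have d: "\<bar>d\<bar> < 1"
    using frac_ge_0[of x] frac_ge_0[of y] frac_lt_1[of x] frac_lt_1[of y]
    unfolding d_def by linarith
  have "x - y + of_int k = d + of_int l"
    by (simp add: d_def l_def frac_def)
  moreover have "min \<bar>d\<bar> (1 - \<bar>d\<bar>) \<le> \<bar>d + of_int l\<bar>"
  proof (cases "l = 0")
    case False
    then have "\<bar>real_of_int l\<bar> \<ge> 1" by linarith
    then show ?thesis using d by linarith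
  qed auto
  ultimately show ?thesis by (simp add: circle_dist_def d_def)
qed

lemma circle_dist_measurable [measurable]:
  "(\<lambda>p. circle_dist (fst p) (snd p)) \<in> borel_measurable (circle \<Otimes>\<^sub>M circle)"
proof -
  have id: "(\<lambda>x. x) \<in> circle \<rightarrow>\<^sub>M borel"
    unfolding circle_def by (rule measurable_restrict_space1) simp
  note [measurable] = measurable_compose[OF measurable_fst id] measurable_compose[OF measurable_snd id]
  show ?thesis unfolding circle_dist_def by measurable
qed

lemma circle_dist_bounds:
  assumes "x \<in> {0..<1}" "y \<in> {0..<1}"
  shows "0 \<le> circle_dist x y" "circle_dist x y \<le> 1"
  using assms by (auto simp: circle_dist_def)

lemma kantorovich_circle_le:
  assumes "\<gamma> \<in> couplings \<mu> \<nu>"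
  shows "kantorovich_circle \<mu> \<nu> \<le> (\<integral>p. circle_dist (fst p) (snd p) \<partial>\<gamma>)"
  unfolding kantorovich_circle_def
proof (rule cINF_lower[OF _ assms])
  \<comment> \<open>A real infimum lies below its members only if the set is bounded below. The cost
    is nonnegative on the circle but not for arbitrary reals, so the space of \<gamma>
    matters.\<close>
  show "bdd_below ((\<lambda>\<gamma>. \<integral>p. circle_dist (fst p) (snd p) \<partial>\<gamma>) ` couplings \<mu> \<nu>)"
  proof (rule bdd_belowI2)
    fix \<gamma> assume "\<gamma> \<in> couplings \<mu> \<nu>"
    then have "sets \<gamma> = sets (circle \<Otimes>\<^sub>M circle)" by (simp add: couplings_def)
    from sets_eq_imp_space_eq[OF this] have "space \<gamma> = {0..<1} \<times> {0..<1}"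
      by (simp add: space_pair_measure)
    then show "0 \<le> (\<integral>p. circle_dist (fst p) (snd p) \<partial>\<gamma>)"
      by (intro Bochner_Integration.integral_nonneg) (auto simp: circle_dist_bounds)
  qed
qed

text \<open>The coupling is the law of \<open>(x (g t), t)\<close>: it moves the cell labelled n, of
  mass 1 / N, to the atom \<open>x n\<close>. Its cost is at most the mean of the cellwise bounds
  B.\<close>

lemma kantorovich_circle_le_cells:
  fixes g :: "real \<Rightarrow> nat"
  assumes \<mu>: "prob_space \<mu>" "sets \<mu> = sets circle"
    and N: "N > 0"
    and x: "\<And>n. x n \<in> {0..<1}"
    and g: "g \<in> circle \<rightarrow>\<^sub>M count_space UNIV" "\<And>t. t \<in> {0..<1} \<Longrightarrow> g t \<in> {1..N}"
    and cell: "\<And>n. n \<in> {1..N} \<Longrightarrow> measure \<mu> {t \<in> {0..<1}. g t = n} = 1 / N"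
    and B: "\<And>t. t \<in> {0..<1} \<Longrightarrow> circle_dist (x (g t)) t \<le> B (g t)"
  shows "kantorovich_circle (empirical_circle x N) \<mu> \<le> (\<Sum>n=1..N. B n) / N"
proof -
  interpret prob_space \<mu> by fact
  have sp: "space \<mu> = {0..<1}" using sets_eq_imp_space_eq[OF \<mu>(2)] by simp
  define T where "T t = (x (g t), t)" for t
  have xg: "(\<lambda>t. x (g t)) \<in> circle \<rightarrow>\<^sub>M circle"
    by (rule measurable_compose[OF g(1)]) (use x in simp)
  then have [measurable]: "T \<in> \<mu> \<rightarrow>\<^sub>M circle \<Otimes>\<^sub>M circle"
    unfolding T_def measurable_cong_sets[OF \<mu>(2) refl] by measurable
  have cells: "{t \<in> {0..<1}. g t = n} \<in> sets \<mu>" for n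
    using measurable_sets[OF g(1), of "{n}"] \<mu>(2) by (simp add: vimage_def Int_def conj_commute)
  define \<gamma> where "\<gamma> = distr \<mu> (circle \<Otimes>\<^sub>M circle) T"
  have "distr \<gamma> circle fst = empirical_circle x N"
  proof (rule measure_eqI)
    fix A assume "A \<in> sets (distr \<gamma> circle fst)"
    then have A: "A \<in> sets circle" by simp
    \<comment> \<open>Indices are collected instead of points, so coinciding \<open>x n\<close>
      count with multiplicity.\<close>
    define S where "S = {n \<in> {1..N}. x n \<in> A}"
    have "distr \<gamma> circle fst = distr \<mu> circle (\<lambda>t. x (g t))"
      unfolding \<gamma>_def by (subst distr_distr) (auto simp: comp_def T_def)
    then have "emeasure (distr \<gamma> circle fst) A = emeasure \<mu> ((\<lambda>t. x (g t)) -` A \<inter> space \<mu>)"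
      using A xg measurable_cong_sets[OF \<mu>(2) refl, of circle] by (simp add: emeasure_distr)
    also have "(\<lambda>t. x (g t)) -` A \<inter> space \<mu> = (\<Union>n\<in>S. {t \<in> {0..<1}. g t = n})"
      using g(2) by (auto simp: sp S_def)
    also have "emeasure \<mu> \<dots> = (\<Sum>n\<in>S. emeasure \<mu> {t \<in> {0..<1}. g t = n})"
      using cells by (intro sum_emeasure[symmetric]) (auto simp: S_def disjoint_family_on_def)
    also have "\<dots> = (\<Sum>n\<in>S. ennreal (1 / N))"
      using cell by (intro sum.cong) (auto simp: S_def emeasure_eq_measure)
    also have "\<dots> = of_nat (card S) / of_nat N"
      using N by (simp add: ennreal_of_nat_eq_real_of_nat divide_ennreal flip: ennreal_mult)
    also have "\<dots> = (\<Sum>n=1..N. emeasure (return circle (x n)) A) / of_nat N"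
      using A by (simp add: S_def indicator_def of_bool_def[symmetric] Int_def flip: sum.inter_filter)
    also have "\<dots> = emeasure (empirical_circle x N) A"
      using A by (simp add: emeasure_empirical_circle)
    finally show "emeasure (distr \<gamma> circle fst) A = emeasure (empirical_circle x N) A" .
  qed simp
  moreover have "distr \<gamma> circle snd = \<mu>"
    unfolding \<gamma>_def using \<mu>(2) by (subst distr_distr) (auto simp: comp_def T_def distr_id2)
  moreover have "prob_space \<gamma>" unfolding \<gamma>_def by (rule prob_space_distr) simp
  ultimately have "\<gamma> \<in> couplings (empirical_circle x N) \<mu>"
    by (simp add: couplings_def \<gamma>_def)
  then have "kantorovich_circle (empirical_circle x N) \<mu> \<le> (\<integral>p. circle_dist (fst p) (snd p) \<partial>\<gamma>)"
    by (rule kantorovich_circle_le)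
  also have "\<dots> = (\<integral>t. circle_dist (x (g t)) t \<partial>\<mu>)"
    unfolding \<gamma>_def by (subst integral_distr) (auto simp: T_def)
  \<comment> \<open>Written with indicators of the cells, \<open>B (g t)\<close> is integrable, and
    its integral needs only the masses 1 / N.\<close>
  also have "\<dots> \<le> (\<integral>t. (\<Sum>n=1..N. B n * indicator {t \<in> {0..<1}. g t = n} t) \<partial>\<mu>)"
  proof (rule integral_mono')
    show "integrable \<mu> (\<lambda>t. \<Sum>n = 1..N. B n * indicator {t \<in> {0..<1}. g t = n} t)"
      using cells by (intro Bochner_Integration.integrable_sum integrable_mult_right
        integrable_real_indicator) (auto simp: emeasure_eq_measure)
    fix t assume "t \<in> space \<mu>"
    then have t: "t \<in> {0..<1}" by (simp add: sp)
    have "(\<Sum>n = 1..N. B n * indicator {t \<in> {0..<1}. g t = n} t) = B (g t)"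
      using t g(2)[OF t] by (simp add: indicator_def if_distrib[of "\<lambda>x. _ * x"] cong: if_cong)
    then show "circle_dist (x (g t)) t \<le> (\<Sum>n = 1..N. B n * indicator {t \<in> {0..<1}. g t = n} t)"
      using B[OF t] by simp
    with circle_dist_bounds(1)[OF x t]
    show "0 \<le> (\<Sum>n = 1..N. B n * indicator {t \<in> {0..<1}. g t = n} t)" by (rule order_trans)
  qed
  also have "\<dots> = (\<Sum>n=1..N. B n * measure \<mu> {t \<in> {0..<1}. g t = n})"
  proof (subst Bochner_Integration.integral_sum)
    show "(\<Sum>n=1..N. \<integral>t. B n * indicator {t \<in> {0..<1}. g t = n} t \<partial>\<mu>) =
        (\<Sum>n=1..N. B n * measure \<mu> {t \<in> {0..<1}. g t = n})"
      using cells sets.sets_into_space by (simp add: Int_absorb2)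
  qed (use cells in \<open>intro integrable_mult_right integrable_real_indicator, auto simp: emeasure_eq_measure\<close>)
  also have "\<dots> = (\<Sum>n=1..N. B n) / N"
    using cell by (simp add: sum_divide_distrib)
  finally show ?thesis .
qed

section \<open>Quantile cells of the rotated exponential distribution\<close>

text \<open>On [0, 1] the density b^t ln b / (b - 1) is at least ln b / (b - 1), so quantiles are
  Lipschitz functions of the mass with constant (b - 1) / ln b. The proof uses only exp x >= 1 + x
  and b^s >= 1.\<close>

lemma expo_cdf_gap:
  assumes b: "b > 1" and s: "0 \<le> s" "s \<le> s'" "s' \<le> 1"
  shows "s' - s \<le> (b - 1) / ln b * (expo_cdf b s' - expo_cdf b s)"
proof -
  have "(s' - s) * ln b \<le> b powr (s' - s) - 1"
    using b exp_ge_add_one_self[of "(s' - s) * ln b"] by (simp add: powr_def del: exp_ge_add_one_self)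
  also have "\<dots> \<le> b powr s * (b powr (s' - s) - 1)"
  proof -
    have "b powr s \<ge> 1" "b powr (s' - s) \<ge> 1" using b s by (auto intro!: ge_one_powr_ge_zero)
    then show ?thesis using mult_right_mono[of 1 "b powr s" "b powr (s' - s) - 1"] by simp
  qed
  also have "\<dots> = b powr s' - b powr s" by (simp add: algebra_simps flip: powr_add)
  also have "\<dots> = (b - 1) * (expo_cdf b s' - expo_cdf b s)"
    using b s by (simp add: expo_cdf_eq flip: diff_divide_distrib)
  finally show ?thesis using b by (simp add: field_simps)
qed

text \<open>On the circle both positions and masses matter only modulo 1. The Lipschitz bound for
  quantiles therefore survives a rotation by a and a change of the mass difference by any integer
  l.\<close>

lemma circle_dist_le_expo_cdf:
  assumes b: "b > 1" and s: "s \<in> {0..1}" "s' \<in> {0..1}"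
  shows "circle_dist (frac (s' + a)) (frac (s + a))
    \<le> (b - 1) / ln b * \<bar>expo_cdf b s' - expo_cdf b s + of_int l\<bar>"
proof -
  let ?C = "(b - 1) / ln b" and ?G = "expo_cdf b"
  have C: "?C \<ge> 1" using b ln_le_minus_one[of b] by simp
  have gap: "v - u \<le> ?C * (?G v - ?G u)" if "0 \<le> u" "u \<le> v" "v \<le> 1" for u v
    using expo_cdf_gap[OF b that] .
  have G01: "?G 0 = 0" "?G 1 = 1" using b by (simp_all add: expo_cdf_def)
  have G: "0 \<le> ?G u" "?G u \<le> 1" if "u \<in> {0..1}" for u
    using that expo_cdf_mono[OF b, of 0 u] expo_cdf_mono[OF b, of u 1] by (auto simp: G01)
  have dist: "circle_dist (frac (s' + a)) (frac (s + a)) \<le> \<bar>s' - s + of_int k\<bar>" for k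
    using circle_dist_frac_le[of "s' + a" "s + a" k] by simp
  \<comment> \<open>The path through the point 1 = 0 consists of [v, 1] and [0, u], and each piece
    obeys the Lipschitz bound.\<close>
  have wrap: "u + 1 - v \<le> ?C * (?G u + 1 - ?G v)" if "u \<in> {0..1}" "v \<in> {0..1}" for u v
  proof -
    have "u \<le> ?C * ?G u" "1 - v \<le> ?C * (1 - ?G v)" using gap[of 0 u] gap[of v 1] that by (simp_all add: G01)
    then have "u + 1 - v \<le> ?C * ?G u + ?C * (1 - ?G v)" by linarith
    also have "\<dots> = ?C * (?G u + 1 - ?G v)" by (metis add_diff_eq distrib_left)
    finally show ?thesis .
  qed
  consider "l = 0" | "l = 1" | "l = -1" | "\<bar>l\<bar> \<ge> 2" by linarith
  then show ?thesis
  proof cases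
    case 1
    have "\<bar>s' - s\<bar> \<le> ?C * \<bar>?G s' - ?G s\<bar>"
    proof (cases "s \<le> s'")
      case True
      then show ?thesis using gap[of s s'] s expo_cdf_mono[OF b True] by simp
    next
      case False
      then show ?thesis using gap[of s' s] s expo_cdf_mono[OF b, of s' s] by simp
    qed
    then show ?thesis using dist[of 0] 1 by simp
  next
    case 2
    then show ?thesis using dist[of 1] wrap[OF s(2,1)] s G[OF s(1)] G[OF s(2)]
      by (simp add: add_diff_eq diff_add_eq)
  next
    case 3
    then show ?thesis using dist[of "-1"] wrap[OF s] s G[OF s(1)] G[OF s(2)]
      by (simp add: diff_diff_eq2 add.commute)
  next
    case 4
    \<comment> \<open>For such l the right-hand side is at least 1, since ln b <= b - 1 makes the
      Lipschitz constant at least 1.\<close>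
    have "circle_dist (frac (s' + a)) (frac (s + a)) \<le> 1"
      by (intro circle_dist_bounds) (auto simp: frac_lt_1)
    also have "1 \<le> \<bar>?G s' - ?G s + of_int l\<bar>"
      using 4 G[OF s(1)] G[OF s(2)] by linarith
    also have "\<dots> \<le> ?C * \<dots>" using C mult_right_mono[OF C, of "\<bar>?G s' - ?G s + of_int l\<bar>"] by simp
    finally show ?thesis .
  qed
qed

text \<open>Solving (b^s - 1) / (b - 1) = p for s gives this quantile function.\<close>

lemma expo_cdf_log:
  assumes "b > 1" "0 \<le> p" "p \<le> 1"
  shows "log b (1 + (b - 1) * p) \<in> {0..1}" "expo_cdf b (log b (1 + (b - 1) * p)) = p"
proof -
  have "1 \<le> 1 + (b - 1) * p" using assms by simp
  moreover have "(b - 1) * p \<le> (b - 1) * 1" using assms by (intro mult_left_mono) auto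
  then have "1 + (b - 1) * p \<le> b" by simp
  ultimately show *: "log b (1 + (b - 1) * p) \<in> {0..1}"
    using assms(1) zero_le_log_cancel_iff[of b "1 + (b - 1) * p"]
      log_le_one_cancel_iff[of b "1 + (b - 1) * p"] by (simp del: zero_le_log_cancel_iff log_le_one_cancel_iff)
  then show "expo_cdf b (log b (1 + (b - 1) * p)) = p"
    using assms(1) \<open>1 \<le> 1 + (b - 1) * p\<close> by (simp add: expo_cdf_eq del: zero_le_log_cancel_iff log_le_one_cancel_iff)
qed

text \<open>Adding y undoes the rotation, and a continuous distribution function applied to a
  variable with that distribution is uniform. The cells are therefore the N quantile
  intervals.\<close>

lemma measure_rotated_expo_cell:
  assumes b: "b > 1" and N: "N > 0" and i: "i < N"
  shows "measure (rotated_expo b y) {t \<in> {0..<1}. \<lfloor>real N * expo_cdf b (frac (t + y))\<rfloor> = int i} = 1 / N"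
proof -
  let ?F = "expo_cdf b" let ?P = "interval_measure ?F"
  interpret real_distribution ?P by (rule real_distribution_expo[OF b])
  have F[measurable]: "?F \<in> borel_measurable borel"
    using continuous_expo_cdf[OF b] by (rule borel_measurable_continuous_onI)
  define A where "A = {t \<in> {0..<1}. \<lfloor>real N * ?F (frac (t + y))\<rfloor> = int i}"
  have "Measurable.pred borel (\<lambda>t. \<lfloor>real N * ?F (frac (t + y))\<rfloor> = int i)"
    unfolding frac_def by measurable
  then have "{t. \<lfloor>real N * ?F (frac (t + y))\<rfloor> = int i} \<in> sets borel"
    by (simp add: pred_def)
  then have "{0..<1} \<inter> {t. \<lfloor>real N * ?F (frac (t + y))\<rfloor> = int i} \<in> sets borel" by auto
  then have A: "A \<in> sets circle"
    by (auto simp: sets_circle_iff A_def Int_def)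
  have eq: "rotated_expo b y = distr ?P circle (\<lambda>s. rotation (- y) (frac s))"
    unfolding rotated_expo_def expo_circle_def by (subst distr_distr) (auto simp: comp_def)
  define \<alpha> \<beta> where "\<alpha> = log b (1 + (b - 1) * (i / N))" and "\<beta> = log b (1 + (b - 1) * ((i + 1) / N))"
  have \<alpha>: "\<alpha> \<in> {0..1}" "?F \<alpha> = i / N" and \<beta>: "\<beta> \<in> {0..1}" "?F \<beta> = (i + 1) / N"
    using i expo_cdf_log[OF b, of "i / N"] expo_cdf_log[OF b, of "(i + 1) / N"]
    by (auto simp: \<alpha>_def \<beta>_def)
  have less: "?F u < ?F v \<longleftrightarrow> u < v" if "u \<in> {0..1}" "v \<in> {0..1}" for u v
    using that b by (simp add: expo_cdf_eq divide_less_cancel)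
  have "\<alpha> < \<beta>" using less[OF \<alpha>(1) \<beta>(1)] N by (simp add: \<alpha> \<beta> divide_strict_right_mono)
  have meas: "(\<lambda>s. rotation (- y) (frac s)) \<in> borel \<rightarrow>\<^sub>M circle" by measurable
  let ?A = "(\<lambda>s. rotation (- y) (frac s)) -` A"
  have vA: "?A \<in> sets borel" using measurable_sets[OF meas A] by simp
  have "measure (rotated_expo b y) A = measure ?P ?A"
    unfolding eq using A by (subst measure_distr) auto
  also have "\<dots> = measure ?P {\<alpha>..\<beta>}"
  proof (rule finite_measure_eq_AE)
    \<comment> \<open>The floor makes the cell half-open, while \<open>{\<alpha>..\<beta>}\<close>
      is closed; the endpoint has mass 0.\<close>
    have "AE s in ?P. s \<notin> {\<beta>}"
      using measure_expo_Icc[OF b, of \<beta> \<beta>]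
      by (intro AE_not_in) (auto simp: null_sets_def emeasure_eq_measure)
    with AE_expo[OF b] show "AE s in ?P. s \<in> ?A \<longleftrightarrow> s \<in> {\<alpha>..\<beta>}"
    proof eventually_elim
      fix s assume s: "s \<in> {0<..<1}" "s \<notin> {\<beta>}"
      have "frac (rotation (- y) (frac s) + y) = s"
        using s by (simp add: rotation_def frac_eq[THEN iffD2])
      moreover have "rotation (- y) (frac s) \<in> {0..<1}"
        by (simp add: rotation_def frac_lt_1)
      ultimately have "s \<in> ?A \<longleftrightarrow> real i \<le> N * ?F s \<and> N * ?F s < real i + 1"
        by (simp add: A_def floor_eq_iff)
      also have "\<dots> \<longleftrightarrow> \<not> ?F s < ?F \<alpha> \<and> ?F s < ?F \<beta>"
        using N by (simp add: \<alpha> \<beta> not_less field_simps)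
      also have "\<dots> \<longleftrightarrow> \<alpha> \<le> s \<and> s < \<beta>"
        using s \<alpha>(1) \<beta>(1) by (subst (1 2) less) auto
      finally show "s \<in> ?A \<longleftrightarrow> s \<in> {\<alpha>..\<beta>}" using s(2) by auto
    qed
  qed (use vA in auto)
  also have "\<dots> = 1 / N"
    using measure_expo_Icc[OF b, of \<alpha> \<beta>] \<open>\<alpha> < \<beta>\<close>
    by (simp add: \<alpha> \<beta> flip: diff_divide_distrib)
  finally show ?thesis by (simp add: A_def)
qed

section \<open>Digit sums\<close>

fun digit_sum :: "nat \<Rightarrow> nat \<Rightarrow> nat" where
  "digit_sum b m = (if m = 0 \<or> b < 2 then 0 else m mod b + digit_sum b (m div b))"

text \<open>For b >= 2 this is the sum of floor(m / b^i) over i >= 0, which counts the pairs (j, n)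
  with n >= 1 and b^j n <= m.\<close>

fun floor_sum :: "nat \<Rightarrow> nat \<Rightarrow> nat" where
  "floor_sum b m = (if m = 0 \<or> b < 2 then 0 else m + floor_sum b (m div b))"

text \<open>For b >= 2 and 1 <= n <= N this is the largest j with b^j n <= N. Dividing N instead of
  multiplying n lets N decrease and suits inductions over N.\<close>

function level :: "nat \<Rightarrow> nat \<Rightarrow> nat \<Rightarrow> nat" where
  "level b N n = (if b < 2 \<or> n = 0 \<or> N < b * n then 0 else Suc (level b (N div b) n))"
  by auto
termination
  by (relation "Wellfounded.measure (\<lambda>(b, N, n). N)") (auto intro!: div_less_dividend intro: gr0I)

declare digit_sum.simps [simp del] floor_sum.simps [simp del] level.simps [simp del]

context
  fixes b :: nat
  assumes b: "b \<ge> 2"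
begin

section \<open>Legendre's formula and the jumps of the floor sum\<close>

lemma digit_sum_step: "d < b \<Longrightarrow> digit_sum b (b * q + d) = d + digit_sum b q"
  using b by (subst digit_sum.simps) (auto simp: digit_sum.simps[of b 0])

text \<open>Appended zeros do not count. The error at a moved point thus depends on the digits of n
  itself, and the mean over the atoms becomes a mean over 1..N.\<close>

lemma digit_sum_power_mult: "digit_sum b (b ^ j * n) = digit_sum b n"
  using digit_sum_step[of 0] b by (induction j) (auto simp: mult.assoc)

lemma floor_sum_step: "d < b \<Longrightarrow> floor_sum b (b * q + d) = b * q + d + floor_sum b q"
  using b by (subst floor_sum.simps) (auto simp: floor_sum.simps[of b 0])

text \<open>Legendre's formula with the term i = 0 included, hence b m where the usual form has m.
  The induction splits off the last digit.\<close>

lemma floor_sum_digit_sum: "(real b - 1) * floor_sum b m + digit_sum b m = real b * m"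
proof (induction m rule: less_induct)
  case (less m)
  define q d where "q = m div b" and "d = m mod b"
  have m: "m = b * q + d" and d: "d < b" using b by (simp_all add: q_def d_def)
  show ?case
  proof (cases "m = 0")
    case False
    then have IH: "(real b - 1) * floor_sum b q + digit_sum b q = real b * q"
      using b by (intro less) (simp add: q_def)
    have steps: "floor_sum b m = m + floor_sum b q" "digit_sum b m = d + digit_sum b q"
      unfolding m using floor_sum_step[OF d] digit_sum_step[OF d] by blast+
    have "(real b - 1) * floor_sum b m + digit_sum b m = (real b - 1) * m + (real b * q + d)"
      unfolding steps using IH by (simp add: algebra_simps)
    also have "\<dots> = real b * m" by (simp add: m algebra_simps)
    finally show ?thesis .
  qed (simp add: floor_sum.simps[of b 0] digit_sum.simps[of b 0])
qed

lemma floor_sum_mono: "m \<le> m' \<Longrightarrow> floor_sum b m \<le> floor_sum b m'"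
proof (induction m' arbitrary: m rule: less_induct)
  case (less m')
  show ?case
  proof (cases "m = 0 \<or> m' = 0")
    case False
    then have "m' div b < m'" "m div b \<le> m' div b" using b less.prems by (auto intro: div_le_mono)
    from less.IH[OF this] show ?thesis
      using False b less.prems by (simp add: floor_sum.simps[of b m] floor_sum.simps[of b m'])
  qed (use less.prems in \<open>auto simp: floor_sum.simps[of b 0]\<close>)
qed

text \<open>Each of the j + 1 quotients by b^0, ..., b^j is an integer at b^j n, so each of these
  floors drops at b^j n - 1.\<close>

lemma floor_sum_gap:
  assumes "n > 0"
  shows "floor_sum b (b ^ j * n - 1) + j < floor_sum b (b ^ j * n)"
proof (induction j)
  case 0
  have "floor_sum b (n - 1) \<le> n - 1 + floor_sum b (n div b)"
    using b floor_sum_mono[of "(n - 1) div b" "n div b"]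
    by (subst floor_sum.simps) (auto simp: div_le_mono)
  then show ?case using b assms by (simp add: floor_sum.simps[of b n])
next
  case (Suc j)
  define M where "M = b ^ j * n"
  have M: "M > 0" using b assms by (simp add: M_def)
  \<comment> \<open>The predecessor of b M ends in the digit b - 1 and has quotient M - 1, which
    leads back to the induction hypothesis.\<close>
  have "b * M - 1 = b * (M - 1) + (b - 1)" using M b by (cases M) auto
  then have "floor_sum b (b * M - 1) = b * M - 1 + floor_sum b (M - 1)"
    using floor_sum_step[of "b - 1" "M - 1"] b by simp
  moreover have "floor_sum b (b * M) = b * M + floor_sum b M"
    using floor_sum_step[of 0 M] b by simp
  moreover have "b * M > 0" using M b by simp
  ultimately have "floor_sum b (b * M - 1) + Suc j < floor_sum b (b * M)"
    using Suc.IH[folded M_def] by linarith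
  then show ?case by (simp add: M_def mult.assoc)
qed

section \<open>The moved points and their ranks\<close>

lemma level_bounds:
  assumes "n > 0" "n \<le> N"
  shows "b ^ level b N n * n \<le> N" "N < b * (b ^ level b N n * n)"
proof -
  have "b ^ level b N n * n \<le> N \<and> N < b * (b ^ level b N n * n)"
    using assms(2)
  proof (induction N rule: less_induct)
    case (less N)
    show ?case
    proof (cases "N < b * n")
      case True
      then show ?thesis using less.prems by (simp add: level.simps[of b N])
    next
      case False
      let ?q = "N div b"
      have q: "?q < N" "n \<le> ?q"
        using False b assms(1) less.prems by (auto simp: less_eq_div_iff_mult_less_eq mult.commute)
      note IH = less.IH[OF q]
      have lev: "level b N n = Suc (level b ?q n)"
        using False b assms(1) by (simp add: level.simps[of b N])
      have "b * (b ^ level b ?q n * n) \<le> b * ?q" using IH by simp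
      also have "\<dots> \<le> N" by simp
      finally have 1: "b ^ level b N n * n \<le> N" by (simp add: lev mult.assoc)
      have "N < b * (?q + 1)" using b dividend_less_times_div[of b N] by simp
      also have "\<dots> \<le> b * (b * (b ^ level b ?q n * n))"
        using IH by (intro mult_left_mono) auto
      finally show ?thesis using 1 by (simp add: lev mult.assoc)
    qed
  qed
  then show "b ^ level b N n * n \<le> N" "N < b * (b ^ level b N n * n)" by blast+
qed

text \<open>Levels enter the rank errors, so their mean has to stay bounded. Only n <= N / b have
  positive level, each 1 more than its level for \<open>N div b\<close>; by induction the total is
  at most 2 (N / b) <= N.\<close>

lemma sum_level_le: "(\<Sum>n=1..N. level b N n) \<le> N"
proof (induction N rule: less_induct)
  case (less N)
  show ?case
  proof (cases "N = 0")
    case False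
    let ?q = "N div b"
    have iff: "N < b * n \<longleftrightarrow> ?q < n" for n
      using b by (simp add: div_less_iff_less_mult mult.commute)
    have "(\<Sum>n=1..N. level b N n) = (\<Sum>n=1..?q. level b N n)"
      using b by (intro sum.mono_neutral_right) (auto simp: level.simps[of b N] iff intro: le_trans)
    also have "\<dots> = (\<Sum>n=1..?q. Suc (level b ?q n))"
      using b by (intro sum.cong) (auto simp: level.simps[of b N] iff)
    also have "\<dots> = ?q + (\<Sum>n=1..?q. level b ?q n)" by (simp add: sum_Suc)
    also have "\<dots> \<le> 2 * ?q" using less[of ?q] False b by simp
    also have "\<dots> \<le> b * ?q" using b by simp
    also have "\<dots> \<le> N" by simp
    finally show ?thesis .
  qed simp
qed

text \<open>
  The atom at \<open>m = b\<^sup>j n\<close> has as many points as there are integers in \<open>(floor_sum b (m - 1), floor_sum b m]\<close>;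
  subtracting the level separates them, so this is, up to a shift, the rank of \<open>n\<close> among the moved points.
\<close>
lemma level_rank_bij:
  assumes "N > 0"
  shows "bij_betw (\<lambda>n. (int (floor_sum b (b ^ level b N n * n)) - int (level b N n) + c) mod int N)
    {1..N} {0..<int N}"
proof -
  define m where "m n = b ^ level b N n * n" for n
  define \<kappa> where "\<kappa> n = int (floor_sum b (m n)) - int (level b N n)" for n
  have gap: "int (floor_sum b (m n - 1)) < \<kappa> n" if "n \<in> {1..N}" for n
    using floor_sum_gap[of n "level b N n"] that by (simp add: \<kappa>_def m_def)
  have le: "\<kappa> n \<le> int (floor_sum b (m n))" for n by (simp add: \<kappa>_def)
  \<comment> \<open>The intervals (floor_sum (m - 1), floor_sum m] for different m are disjoint and
    ordered like m.\<close>
  have less: "\<kappa> n < \<kappa> n'" if "n' \<in> {1..N}" "m n < m n'" for n n'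
  proof -
    have "floor_sum b (m n) \<le> floor_sum b (m n' - 1)" using that(2) by (intro floor_sum_mono) simp
    then show ?thesis using le[of n] gap[OF that(1)] by linarith
  qed
  have inj: "n = n'" if "n \<in> {1..N}" "n' \<in> {1..N}" "\<kappa> n = \<kappa> n'" for n n'
  proof -
    have meq: "m n = m n'" using less[OF that(1), of n'] less[OF that(2), of n] that(3)
      by (metis linorder_neqE_nat less_irrefl)
    then have "level b N n = level b N n'" using that(3) by (simp add: \<kappa>_def)
    then show ?thesis using meq b by (simp add: m_def)
  qed
  \<comment> \<open>As \<open>floor_sum b N = N + floor_sum b (N div b)\<close>, all values lie
    among N consecutive integers and remain distinct modulo N after any shift c. Surjectivity then
    follows by counting.\<close>
  have range: "\<kappa> n \<in> {int (floor_sum b (N div b))<..int (floor_sum b (N div b)) + int N}"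
    if n: "n \<in> {1..N}" for n
  proof -
    have m: "m n \<le> N" "N < b * m n" using level_bounds[of n N] n by (auto simp: m_def)
    then have "N div b < m n" using b by (simp add: div_less_iff_less_mult mult.commute)
    then have "N div b \<le> m n - 1" by simp
    then have "floor_sum b (N div b) \<le> floor_sum b (m n - 1)" by (rule floor_sum_mono)
    moreover have "floor_sum b (m n) \<le> floor_sum b N" using m by (intro floor_sum_mono)
    moreover have "floor_sum b N = N + floor_sum b (N div b)"
      using b assms by (simp add: floor_sum.simps[of b N])
    ultimately show ?thesis using gap[OF n] le[of n] by auto
  qed
  have "inj_on (\<lambda>n. (\<kappa> n + c) mod int N) {1..N}"
  proof (rule inj_onI)
    fix n n' assume n: "n \<in> {1..N}" "n' \<in> {1..N}" and eq: "(\<kappa> n + c) mod int N = (\<kappa> n' + c) mod int N"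
    then have "int N dvd \<kappa> n - \<kappa> n'" by (simp add: mod_eq_dvd_iff)
    moreover have "\<bar>\<kappa> n - \<kappa> n'\<bar> < int N" using range[OF n(1)] range[OF n(2)] by auto
    ultimately have "\<kappa> n = \<kappa> n'" using dvd_imp_le_int[of "\<kappa> n - \<kappa> n'" "int N"] by fastforce
    then show "n = n'" using inj n by blast
  qed
  moreover from this have "(\<lambda>n. (\<kappa> n + c) mod int N) ` {1..N} = {0..<int N}"
    using assms by (intro card_subset_eq) (auto simp: card_image)
  ultimately show ?thesis by (simp add: bij_betw_def \<kappa>_def m_def)
qed

section \<open>The mean square deviation of the digit sum\<close>

lemma digit_sum_variance:
  "(\<Sum>n<b ^ J. (real (digit_sum b n) - J * (real b - 1) / 2)\<^sup>2) \<le> real (b ^ J) * J * (real b)\<^sup>2"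
proof (induction J)
  case 0
  then show ?case by (simp add: digit_sum.simps[of b 0] lessThan_Suc)
next
  case (Suc J)
  define a where "a = (real b - 1) / 2"
  define e where "e q = real (digit_sum b q) - J * a" for q
  have IH: "(\<Sum>q<b ^ J. (e q)\<^sup>2) \<le> real (b ^ J) * J * (real b)\<^sup>2"
    using Suc by (simp add: e_def a_def)
  have sum0: "(\<Sum>d<b. real d - a) = 0"
  proof -
    have "2 * (\<Sum>d<k. real d) = real k * (real k - 1)" for k
      by (induction k) (auto simp: algebra_simps)
    from this[of b] show ?thesis by (simp add: sum_subtractf a_def algebra_simps)
  qed
  have sq: "(\<Sum>d<b. (real d - a)\<^sup>2) \<le> real b * (real b)\<^sup>2"
  proof -
    have "(real d - a)\<^sup>2 \<le> (real b)\<^sup>2" if "d < b" for d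
    proof (rule power2_le_iff_abs_le[THEN iffD2])
      show "\<bar>real d - a\<bar> \<le> real b" using that b by (auto simp: a_def abs_le_iff field_simps)
    qed simp
    then show ?thesis using sum_bounded_above[of "{..<b}" "\<lambda>d. (real d - a)\<^sup>2" "(real b)\<^sup>2"] by simp
  qed
  have "(\<Sum>n<b ^ Suc J. (real (digit_sum b n) - Suc J * a)\<^sup>2)
      = (\<Sum>q<b ^ J. \<Sum>n=q * b..<q * b + b. (real (digit_sum b n) - Suc J * a)\<^sup>2)"
    by (subst sum.nat_group) (simp add: mult.commute)
  also have "\<dots> = (\<Sum>q<b ^ J. \<Sum>d<b. (e q + (real d - a))\<^sup>2)"
  proof (rule sum.cong[OF refl])
    fix q
    have "(\<Sum>n=q * b..<q * b + b. (real (digit_sum b n) - Suc J * a)\<^sup>2)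
        = (\<Sum>d<b. (real (digit_sum b (b * q + d)) - Suc J * a)\<^sup>2)"
      using sum.shift_bounds_nat_ivl[of "\<lambda>n. (real (digit_sum b n) - Suc J * a)\<^sup>2" 0 "q * b" b]
      by (simp add: add.commute mult.commute lessThan_atLeast0)
    also have "\<dots> = (\<Sum>d<b. (e q + (real d - a))\<^sup>2)"
      by (intro sum.cong refl) (simp_all add: digit_sum_step e_def, simp add: algebra_simps)
    finally show "(\<Sum>n=q * b..<q * b + b. (real (digit_sum b n) - Suc J * a)\<^sup>2) = \<dots>" .
  qed
  \<comment> \<open>For fixed leading digits q the last digit d has mean a, so the cross term
    vanishes and the variances of the digits add up.\<close>
  also have "\<dots> = (\<Sum>q<b ^ J. real b * (e q)\<^sup>2 + 2 * e q * (\<Sum>d<b. real d - a) + (\<Sum>d<b. (real d - a)\<^sup>2))"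
    by (simp only: power2_sum sum.distrib sum_distrib_left[symmetric] mult.assoc)
      (simp add: sum_distrib_left)
  also have "\<dots> = real b * (\<Sum>q<b ^ J. (e q)\<^sup>2) + real (b ^ J) * (\<Sum>d<b. (real d - a)\<^sup>2)"
    by (simp add: sum0 sum.distrib sum_distrib_left)
  also have "\<dots> \<le> real b * (real (b ^ J) * J * (real b)\<^sup>2) + real (b ^ J) * (real b * (real b)\<^sup>2)"
    using IH sq by (intro add_mono mult_left_mono) auto
  also have "\<dots> = real (b ^ Suc J) * Suc J * (real b)\<^sup>2" by (simp add: algebra_simps)
  finally show ?case by (simp add: a_def)
qed

text \<open>Cauchy-Schwarz reduces the claim to squares, and the sum is extended to all numbers with
  at most J digits. As b^J <= b N, this costs only a factor b, which makes b^3 out of the b^2 in the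
  variance bound.\<close>

lemma sum_abs_digit_sum_deviation_le:
  assumes J: "b ^ J \<le> b * N" "N < b ^ J"
  shows "(\<Sum>n=1..N. \<bar>real (digit_sum b n) - J * (real b - 1) / 2\<bar>) \<le> N * sqrt (real b ^ 3 * J)"
proof -
  define e where "e n = real (digit_sum b n) - J * (real b - 1) / 2" for n
  have "(\<Sum>n=1..N. \<bar>e n\<bar>)\<^sup>2 \<le> (\<Sum>n=1..N. \<bar>e n\<bar>\<^sup>2) * real (card {1..N})"
    by (rule sum_squared_le_sum_of_squares)
  also have "\<dots> = N * (\<Sum>n=1..N. (e n)\<^sup>2)" by simp
  also have "(\<Sum>n=1..N. (e n)\<^sup>2) \<le> (\<Sum>n<b ^ J. (e n)\<^sup>2)"
    using J(2) by (intro sum_mono2) auto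
  also have "\<dots> \<le> real (b ^ J) * J * (real b)\<^sup>2"
    unfolding e_def by (rule digit_sum_variance)
  also have "\<dots> \<le> real (b * N) * J * (real b)\<^sup>2"
    using J(1) by (intro mult_right_mono) (simp_all only: of_nat_le_iff of_nat_0_le_iff zero_le_power2)
  also have "N * (real (b * N) * J * (real b)\<^sup>2) = (N * sqrt (real b ^ 3 * J))\<^sup>2"
    by (simp add: power_mult_distrib power2_eq_square power3_eq_cube)
  finally show ?thesis unfolding e_def[symmetric] by (rule power2_le_imp_le) (simp_all add: mult_left_mono)
qed

end

section \<open>The discrepancy of the logarithms\<close>

text \<open>The centre a is free because ranks on the circle may be shifted cyclically. Index n
  receives the quantile cell with number \<open>i n\<close>, and its rank error is a digit sum
  deviation up to the level and rounding.\<close>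

lemma kantorovich_circle_log_le:
  fixes b N :: nat and a :: real
  assumes b: "b \<ge> 2" and N: "N > 0"
  shows "kantorovich_circle (empirical_circle (\<lambda>n. frac (log b n)) N) (rotated_expo b (frac (- log b N)))
    \<le> (\<Sum>n=1..N. (real b - 1) / ln b / N * (\<bar>real (digit_sum b n) - a\<bar> + level b N n + 2)) / N"
proof -
  define y where "y = frac (- log b N)"
  \<comment> \<open>By Legendre's formula \<open>\<kappa> n\<close> differs from the exact rank by
    (N - s(n)) / (b - 1) minus the level, s being the digit sum. This shift replaces N by a, up to
    rounding.\<close>
  define c where "c = \<lfloor>(a - N) / (real b - 1)\<rfloor>"
  define m where "m n = b ^ level b N n * n" for n
  define \<kappa> where "\<kappa> n = int (floor_sum b (m n)) - int (level b N n)" for n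
  define i where "i n = (\<kappa> n + c) mod int N" for n
  define V where "V t = N * expo_cdf b (frac (t + y))" for t
  \<comment> \<open>\<open>\<lfloor>V t\<rfloor>\<close> numbers the quantile cell of t, and g
    returns the index to which that cell is assigned.\<close>
  define g where "g t = inv_into {1..N} i \<lfloor>V t\<rfloor>" for t
  have b1: "real b > 1" using b by simp
  have bij: "bij_betw i {1..N} {0..<int N}"
    using level_rank_bij[OF b N, of c] by (simp add: i_def[abs_def] \<kappa>_def m_def)
  have V: "\<lfloor>V t\<rfloor> \<in> {0..<int N}" for t
  proof -
    define s where "s = frac (t + y)"
    have s: "0 \<le> s" "s < 1" by (simp_all add: s_def frac_lt_1)
    then have "b powr s \<ge> 1" "b powr s < b powr 1"
      using b1 by (intro ge_one_powr_ge_zero powr_less_mono; simp)+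
    then have "0 \<le> expo_cdf b s" "expo_cdf b s < 1"
      using s b1 by (simp_all add: expo_cdf_eq)
    then show ?thesis using N by (simp add: V_def s_def floor_less_iff)
  qed
  have g: "g t \<in> {1..N}" "i (g t) = \<lfloor>V t\<rfloor>" for t
    using V[of t] bij inv_into_into[of "\<lfloor>V t\<rfloor>" i "{1..N}"] f_inv_into_f[of "\<lfloor>V t\<rfloor>" i "{1..N}"]
    by (simp_all add: g_def bij_betw_def)
  show ?thesis unfolding y_def[symmetric]
  proof (rule kantorovich_circle_le_cells[where g = g])
    show "prob_space (rotated_expo b y)" using b1 by (rule prob_space_rotated_expo)
    show "sets (rotated_expo b y) = sets circle" by (simp add: rotated_expo_def)
    show "frac (log b n) \<in> {0..<1}" for n by (simp add: frac_lt_1)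
    show "g \<in> circle \<rightarrow>\<^sub>M count_space UNIV"
    proof -
      have [measurable]: "expo_cdf b \<in> borel_measurable borel"
        using continuous_expo_cdf[OF b1] by (rule borel_measurable_continuous_onI)
      have "(\<lambda>t. \<lfloor>V t\<rfloor>) \<in> borel \<rightarrow>\<^sub>M count_space UNIV"
        unfolding V_def frac_def by measurable
      then have "(\<lambda>t. \<lfloor>V t\<rfloor>) \<in> circle \<rightarrow>\<^sub>M count_space UNIV"
        unfolding circle_def by (rule measurable_restrict_space1)
      then show ?thesis unfolding g_def by (rule measurable_compose) simp
    qed
    fix n assume n: "n \<in> {1..N}"
    then have i: "i n \<in> {0..<int N}" using bij by (auto simp: bij_betw_def)
    have "g t = n \<longleftrightarrow> \<lfloor>V t\<rfloor> = int (nat (i n))" for t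
      using g[of t] n i bij inj_onD[of i "{1..N}" "g t" n] by (auto simp: bij_betw_def)
    then show "measure (rotated_expo b y) {t \<in> {0..<1}. g t = n} = 1 / N"
      using measure_rotated_expo_cell[OF b1 N, of "nat (i n)" y] i by (auto simp: V_def nat_less_iff)
  next
    fix t :: real assume t: "t \<in> {0..<1}"
    show "g t \<in> {1..N}" by (rule g)
    define n where "n = g t"
    have n: "n \<in> {1..N}" "i n = \<lfloor>V t\<rfloor>" unfolding n_def by (rule g)+
    have m: "m n \<le> N" "N < b * m n" using level_bounds[OF b, of n N] n(1) by (auto simp: m_def)
    have "m n > 0" using m(2) by (cases "m n") auto
    \<comment> \<open>p is the uniform distribution function on (N/b, N] at the moved point
      \<open>m n\<close>. Its quantile s' turns out to be a lift of the point of n, rotated by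
      y.\<close>
    define p where "p = (b * real (m n) - N) / ((real b - 1) * N)"
    define s where "s = frac (t + y)"
    define s' where "s' = log b (1 + (real b - 1) * p)"
    have p: "0 \<le> p" "p \<le> 1"
    proof -
      have "real N < real b * real (m n)" using m(2) by (metis of_nat_less_iff of_nat_mult)
      then show "0 \<le> p" using b1 by (simp add: p_def)
      have "real b * real (m n) \<le> real b * real N" using m(1) by (intro mult_left_mono) auto
      then show "p \<le> 1" using b1 N by (simp add: p_def algebra_simps)
    qed
    have s': "s' \<in> {0..1}" "expo_cdf b s' = p"
      unfolding s'_def using expo_cdf_log[OF b1 p] by blast+
    have s: "s \<in> {0..1}" by (auto simp: s_def less_imp_le frac_lt_1)
    have "1 + (real b - 1) * p = b * real (m n) / N" using b1 N by (simp add: p_def field_simps)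
    also have "log b \<dots> = 1 + level b N n + log b n - log b N"
      using b1 N n(1) by (simp add: m_def log_mult log_divide log_nat_power)
    finally have s'_eq: "s' = 1 + level b N n + log b n - log b N" by (simp add: s'_def)
    have "s' - y = log b n + of_int (1 + int (level b N n) + \<lfloor>- log b N\<rfloor>)"
      by (simp add: s'_eq y_def frac_def)
    then have fs': "frac (s' + - y) = frac (log b n)"
      by (simp only: diff_conv_add_uminus[symmetric]) (simp add: frac_def)
    have "s - y = t + of_int (- \<lfloor>t + y\<rfloor>)" by (simp add: s_def frac_def)
    then have "frac (s - y) = frac t" by (simp only:) (simp add: frac_def)
    then have fs: "frac (s + - y) = t" using t by (simp add: frac_eq)
    \<comment> \<open>Reduction modulo N drops q full turns; the circle estimate is applied with l =
      -q to restore them.\<close>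
    define q where "q = (\<kappa> n + c) div int N"
    define f where "f = frac (V t)"
    have f: "0 \<le> f" "f < 1" by (simp_all add: f_def frac_lt_1)
    have "V t = of_int (\<kappa> n + c - int N * q) + f"
      using n(2) by (simp add: f_def frac_def i_def q_def minus_mult_div_eq_mod)
    then have Gs: "expo_cdf b s = (\<kappa> n + c - real N * q + f) / N"
      using N by (simp add: V_def s_def field_simps)
    have Gs': "p = (b * real (m n) - N) / (real b - 1) / N" by (simp add: p_def)
    have ds: "digit_sum b (m n) = digit_sum b n" by (simp add: m_def digit_sum_power_mult[OF b])
    have "(real b - 1) * floor_sum b (m n) = b * real (m n) - digit_sum b n"
      using floor_sum_digit_sum[OF b, of "m n"] ds by simp
    then have "floor_sum b (m n) = (b * real (m n) - digit_sum b n) / (real b - 1)"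
      using b1 by (simp add: field_simps)
    then have \<kappa>: "real_of_int (\<kappa> n) = (b * real (m n) - digit_sum b n) / (real b - 1) - level b N n"
      by (simp add: \<kappa>_def)
    \<comment> \<open>r is the rounding error of c, and f the position of t within its cell. Both
      lie in [0, 1), which the constant 2 covers.\<close>
    define r where "r = (a - N) / (real b - 1) - c"
    have r: "0 \<le> r" "r < 1" unfolding r_def c_def by linarith+
    have "p - expo_cdf b s + of_int (- q)
        = ((b * real (m n) - N) / (real b - 1) - \<kappa> n - c - f) / N"
      unfolding Gs Gs' using N by (simp add: add_divide_distrib diff_divide_distrib)
    also have "\<dots> = ((digit_sum b n - a) / (real b - 1) + level b N n + r - f) / N"
      unfolding \<kappa> r_def by (rule arg_cong[where f = "\<lambda>x. x / N"]) (simp add: diff_divide_distrib)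
    finally have eq: "p - expo_cdf b s + of_int (- q) = \<dots>" .
    have "\<bar>(real (digit_sum b n) - a) / (real b - 1)\<bar> \<le> \<bar>real (digit_sum b n) - a\<bar>"
      using b by (simp add: abs_divide divide_le_eq mult_left_le mult_le_cancel_left1)
    then have "\<bar>(digit_sum b n - a) / (real b - 1) + level b N n + r - f\<bar>
        \<le> \<bar>real (digit_sum b n) - a\<bar> + level b N n + 2"
      using r f by linarith
    then have *: "\<bar>p - expo_cdf b s + of_int (- q)\<bar> \<le> (\<bar>real (digit_sum b n) - a\<bar> + level b N n + 2) / N"
      unfolding eq abs_divide using N by (simp add: divide_right_mono)
    have "circle_dist (frac (log b n)) t \<le> (real b - 1) / ln b * \<bar>p - expo_cdf b s + of_int (- q)\<bar>"
      using circle_dist_le_expo_cdf[OF b1 s s'(1), of "- y" "- q"] unfolding fs fs' s'(2) .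
    also have "\<dots> \<le> (real b - 1) / ln b * ((\<bar>real (digit_sum b n) - a\<bar> + level b N n + 2) / N)"
      using b1 by (intro mult_left_mono[OF *]) simp
    finally show "circle_dist (frac (log b (g t))) t
        \<le> (real b - 1) / ln b / N * (\<bar>real (digit_sum b (g t)) - a\<bar> + level b N (g t) + 2)"
      by (simp add: n_def)
  qed (use N in auto)
qed

section \<open>From the bound at each N to the limit superior\<close>

theorem theorem2:
  fixes b :: nat
  assumes "b \<ge> 2"
  shows "limsup (\<lambda>N. ereal (real N / sqrt (ln (real N)) *
           kantorovich_circle
             (empirical_circle (\<lambda>n. frac (log (real b) (real n))) N)
             (rotated_expo (real b) (frac (- log (real b) (real N)))))) < \<infinity>"
proof -
  define C where "C = (real b - 1) / ln b"
  \<comment> \<open>The root comes from the digit sums with J <= 4 ln N. The 6 covers the 1 from the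
    mean level and the 2 from rounding, absorbed by sqrt (ln N) >= 1; this is where N >= 3 >= exp 1
    enters.\<close>
  define D where "D = C * (sqrt (4 * real b ^ 3) + 6)"
  have C: "C \<ge> 0" using assms by (simp add: C_def)
  have "real N / sqrt (ln N) * kantorovich_circle
      (empirical_circle (\<lambda>n. frac (log b n)) N) (rotated_expo b (frac (- log b N))) \<le> D"
    (is "_ * ?K \<le> _") if N: "N \<ge> 3" for N
  proof -
    \<comment> \<open>J is the number of base-b digits of N.\<close>
    define J where "J = Suc (level b N 1)"
    have J: "b ^ J \<le> b * N" "N < b ^ J"
      using level_bounds[OF assms, of 1 N] N by (simp_all add: J_def)
    have ln2: "ln (2::real) \<ge> 1 / 2" using ln2_ge_two_thirds by simp
    have lnN: "ln N \<ge> 1"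
      using N exp_le ln_ge_iff[of "real N" 1] by simp
    \<comment> \<open>As ln 2 >= 1/2, the level of 1 is at most 2 ln N, and the additional 1 is at
      most ln N.\<close>
    have "J \<le> 4 * ln N"
    proof -
      have "2 ^ level b N 1 \<le> b ^ level b N 1" using assms by (intro power_mono) auto
      also have "\<dots> \<le> N" using level_bounds(1)[OF assms, of 1 N] N by simp
      finally have "real (2 ^ level b N 1) \<le> real N" by (simp only: of_nat_le_iff)
      then have "ln (2 ^ level b N 1) \<le> ln N" using N by (subst ln_le_cancel_iff) auto
      then have "level b N 1 * ln 2 \<le> ln N" by (simp add: ln_realpow)
      moreover have "level b N 1 * (1 / 2) \<le> level b N 1 * ln (2::real)"
        using ln2 by (intro mult_left_mono) auto
      ultimately show ?thesis using lnN by (simp add: J_def)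
    qed
    define a where "a = J * (real b - 1) / 2"
    have "?K \<le> (\<Sum>n=1..N. C / N * (\<bar>real (digit_sum b n) - a\<bar> + level b N n + 2)) / N"
      unfolding C_def using N by (intro kantorovich_circle_log_le[OF assms]) simp
    also have "\<dots> = C / N * ((\<Sum>n=1..N. \<bar>real (digit_sum b n) - a\<bar>) + real (\<Sum>n=1..N. level b N n) + 2 * N) / N"
      unfolding sum_distrib_left[symmetric] by (simp add: sum.distrib)
    also have "\<dots> \<le> C / N * (N * sqrt (real b ^ 3 * J) + N + 2 * N) / N"
      using sum_abs_digit_sum_deviation_le[OF assms J] sum_level_le[OF assms, of N] C
      by (intro divide_right_mono mult_left_mono add_mono) (simp_all only: a_def of_nat_le_iff, simp_all)
    also have "\<dots> = C / N * (sqrt (real b ^ 3 * J) + 3)" using N by (simp add: field_simps)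
    also have "\<dots> \<le> C / N * (sqrt (4 * real b ^ 3) * sqrt (ln N) + 6 * sqrt (ln N))"
    proof (intro mult_left_mono add_mono)
      have "real b ^ 3 * J \<le> real b ^ 3 * (4 * ln N)"
        using \<open>J \<le> 4 * ln N\<close> by (intro mult_left_mono) auto
      then show "sqrt (real b ^ 3 * J) \<le> sqrt (4 * real b ^ 3) * sqrt (ln N)"
        by (simp add: mult_ac flip: real_sqrt_mult)
      show "3 \<le> 6 * sqrt (ln N)" using lnN real_sqrt_ge_1_iff[of "ln N"] by linarith
    qed (use C in simp)
    finally have "N / sqrt (ln N) * ?K
        \<le> N / sqrt (ln N) * (C / N * (sqrt (4 * real b ^ 3) * sqrt (ln N) + 6 * sqrt (ln N)))"
      using lnN by (intro mult_left_mono) auto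
    also have "\<dots> = D" using N lnN by (simp add: D_def field_simps)
    finally show ?thesis .
  qed
  then have "limsup (\<lambda>N. ereal (real N / sqrt (ln (real N)) * kantorovich_circle
      (empirical_circle (\<lambda>n. frac (log b n)) N) (rotated_expo b (frac (- log b N))))) \<le> ereal D"
    by (intro Limsup_bounded eventually_sequentiallyI[of 3]) simp
  then show ?thesis by (rule le_less_trans) simp
qed

end
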